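(* Let $X$ be a topological space in which every open set is a union of countably many clopen sets, and let $\alpha$ be an ordinal with $0<\alpha\le\omega_1$. The following are equivalent: (1) for every function $\Psi:X\to\mathbb{N}^{\mathbb{N}}$ of Baire class $\alpha$, $\Psi[X]$ is bounded; (2) for every Borel function $\Psi:X\to\mathbb{N}^{\mathbb{N}}$, $\Psi[X]$ is bounded.
   Context: Functions $X\to\mathbb{N}^{\mathbb{N}}$ of Baire class $0$ are the continuous ones; for $0<\alpha\le\omega_1$, a function is of Baire class $\alpha$ if it is the pointwise limit of a sequence of functions each of Baire class smaller than $\alpha$. The Baire class $1$ functions are exactly those for which the preimage of every open set is $F_\sigma$, and the Borel functions are exactly those of Baire class $\omega_1$. $Y\subseteq\mathbb{N}^{\mathbb{N}}$ is bounded if there is $g\in\mathbb{N}^{\mathbb{N}}$ such that each $f\in Y$ satisfies $f(n)\le g(n)$ for all but finitely many $n$. *)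

theory Defs
  imports "HOL-Analysis.Analysis"
begin

text \<open>Ordinals are represented by positions in a well-order: the position i in the
well-order r stands for the ordinal alpha = order type of the strict initial segment
{j. (j,i) in r, j ~= i}.  The Baire class hierarchy only depends on this order type.\<close>

definition strict_below :: "'i rel \<Rightarrow> 'i \<Rightarrow> 'i set" where
  "strict_below r i = {j. (j, i) \<in> r \<and> j \<noteq> i}"

inductive baire_class :: "'i rel \<Rightarrow> 'i \<Rightarrow> ('a::topological_space \<Rightarrow> (nat \<Rightarrow> nat)) \<Rightarrow> bool"
  for r :: "'i rel" where
  class_zero: "\<lbrakk>i \<in> Field r; strict_below r i = {}; continuous_on UNIV f\<rbrakk>
                 \<Longrightarrow> baire_class r i f"
| class_limit: "\<lbrakk>i \<in> Field r; strict_below r i \<noteq> {};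
                 \<forall>n. \<exists>j \<in> strict_below r i. baire_class r j (F n);
                 \<forall>x. (\<lambda>n. F n x) \<longlonglongrightarrow> f x\<rbrakk>
                 \<Longrightarrow> baire_class r i f"

definition ord_le_omega1 :: "'i rel \<Rightarrow> 'i \<Rightarrow> bool" where
  "ord_le_omega1 r i \<longleftrightarrow> (\<forall>k \<in> strict_below r i. countable (strict_below r k))"

definition bounded_NN :: "(nat \<Rightarrow> nat) set \<Rightarrow> bool" where
  "bounded_NN Y \<longleftrightarrow> (\<exists>g. \<forall>f \<in> Y. \<forall>\<^sub>F n in sequentially. f n \<le> g n)"

end

theory Submission
  imports Defs
begin

text \<open>Pointwise limits of continuous functions are of class \<open>\<alpha>\<close> because \<open>\<alpha> > 0\<close>, and
  their boundedness already bounds every Borel function. Applied to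
  \<open>\<lambda>x n. LEAST c. x \<in> C n c\<close>, where each \<open>C n\<close> is a sequence of closed sets covering the space, it yields a
  \<open>g\<close> such that every point lies in \<open>\<Union>c\<le>g n. C n c\<close> for almost all \<open>n\<close>. For a set
  \<open>\<Inter>n. U n\<close> with \<open>U\<close> decreasing and \<open>U n\<close> the increasing union of the clopen sets \<open>D n c\<close>,
  take the covers \<open>- U n \<union> D n c\<close>: then \<open>\<Inter>n. U n\<close> equals \<open>\<Union>m. \<Inter>n\<ge>m. D n (g n)\<close>.
  So every \<open>G\<^sub>\<delta>\<close> set, and hence every Borel set, is \<open>F\<^sub>\<sigma>\<close>. For a Borel function \<open>\<Psi>\<close>
  the sets \<open>{x. \<Psi> x n \<le> k}\<close> can therefore be split into countably many closed sets, and the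
  covering property bounds \<open>\<Psi>\<close>.\<close>

section \<open>Continuity and convergence for functions into \<open>nat\<close> and into its
  power\<close>

text \<open>Each fibre is a finite Boolean combination of clopen sets, and \<open>nat\<close> is
  discrete.\<close>

lemma continuous_on_Least_clopen:
  fixes P :: "nat \<Rightarrow> 'a::topological_space \<Rightarrow> bool"
  assumes "\<And>c. open {x. P c x}" "\<And>c. closed {x. P c x}" and ex: "\<And>x. \<exists>c. P c x"
  shows "continuous_on UNIV (\<lambda>x. LEAST c. P c x)"
proof -
  have fib: "open {x. (LEAST c. P c x) = k}" for k
  proof -
    have "(LEAST c. P c x) = k \<longleftrightarrow> P k x \<and> (\<forall>c<k. \<not> P c x)" for x
      using LeastI_ex[OF ex[of x]] not_less_Least by (metis linorder_neqE_nat)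
    then have "{x. (LEAST c. P c x) = k} = {x. P k x} \<inter> (\<Inter>c<k. - {x. P c x})"
      by auto
    with assms show ?thesis
      by (auto intro!: open_INT)
  qed
  have "open ((\<lambda>x. LEAST c. P c x) -` B)" for B
  proof -
    have "(\<lambda>x. LEAST c. P c x) -` B = (\<Union>k\<in>B. {x. (LEAST c. P c x) = k})"
      by auto
    with fib show ?thesis
      by auto
  qed
  then show ?thesis
    by (simp add: continuous_on_open_vimage)
qed

lemma tendsto_fun_nat_iff:
  fixes F :: "'b \<Rightarrow> 'c \<Rightarrow> nat"
  shows "(F \<longlongrightarrow> f) net \<longleftrightarrow> (\<forall>n. \<forall>\<^sub>F m in net. F m n = f n)"
proof -
  have "(F \<longlongrightarrow> f) net \<longleftrightarrow> limitin (product_topology (\<lambda>_. euclidean) UNIV) F f net"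
    by (simp add: euclidean_product_topology)
  also have "\<dots> \<longleftrightarrow> (\<forall>n. \<forall>\<^sub>F m in net. F m n = f n)"
    by (simp add: limitin_componentwise tendsto_discrete)
  finally show ?thesis .
qed

lemma fsigma_in_closed_sequence:
  assumes "fsigma_in euclidean S"
  shows "\<exists>E::nat \<Rightarrow> 'a::topological_space set. (\<forall>m. closed (E m)) \<and> S = \<Union>(range E)"
proof -
  obtain E where "\<forall>n::nat. closedin euclidean (E n)" "\<Union>(range E) = S"
    using assms by (auto simp only: fsigma_in_ascending)
  then show ?thesis
    by (intro exI[of _ E]) simp
qed

section \<open>Clopen exhaustions of open sets\<close>

locale countable_union_clopen =
  fixes dummy :: "'a::topological_space itself"
  assumes open_countable_union_clopen:
    "\<And>U::'a set. open U \<Longrightarrow> \<exists>C. countable C \<and> (\<forall>c\<in>C. open c \<and> closed c) \<and> U = \<Union>C"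
begin

lemma open_increasing_clopen:
  fixes U :: "'a set"
  assumes "open U"
  obtains D :: "nat \<Rightarrow> 'a set"
  where "\<And>j. open (D j)" "\<And>j. closed (D j)" "incseq D" "U = (\<Union>j. D j)"
proof -
  obtain C where C: "countable C" "\<And>c. c \<in> C \<Longrightarrow> open c \<and> closed c" "U = \<Union>C"
    using open_countable_union_clopen[OF assms] by auto
  \<comment> \<open>Inserting the empty set makes the enumerated family nonempty, which covers the
    case \<open>C = {}\<close>.\<close>
  define e where "e = from_nat_into (insert {} C)"
  have rng: "range e = insert {} C"
    unfolding e_def by (rule range_from_nat_into) (use C in auto)
  have e: "open (e k) \<and> closed (e k)" for k
    using rng C(2) by (metis closed_empty insertE open_empty rangeI)
  show ?thesis
  proof (rule that[of "\<lambda>j. \<Union>k\<le>j. e k"])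
    show "incseq (\<lambda>j. \<Union>k\<le>j. e k)"
      by (force simp: incseq_def)
    have "U = \<Union>(range e)"
      by (simp add: rng C)
    then show "U = (\<Union>j. \<Union>k\<le>j. e k)"
      by auto
  qed (use e in auto)
qed

end

section \<open>Spaces on which limits of continuous functions have bounded range\<close>

locale baire_one_bounded = countable_union_clopen dummy
  for dummy :: "'a::topological_space itself" +
  assumes bounded_limit: "\<And>(F :: nat \<Rightarrow> 'a \<Rightarrow> nat \<Rightarrow> nat) \<Phi>.
    \<lbrakk>\<And>m. continuous_on UNIV (F m); \<And>x. (\<lambda>m. F m x) \<longlonglongrightarrow> \<Phi> x\<rbrakk> \<Longrightarrow> bounded_NN (range \<Phi>)"
begin

text \<open>Each \<open>C n c\<close> is the intersection of the decreasing clopen sets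
  \<open>- D n c j\<close>. Replacing it by its \<open>j\<close>-th approximation makes the least
  index continuous in \<open>x\<close>, and letting \<open>j\<close> grow recovers the true least
  index \<open>\<Phi>\<close>.\<close>

lemma closed_covers_bounded:
  fixes C :: "nat \<Rightarrow> nat \<Rightarrow> 'a set"
  assumes closed: "\<And>n c. closed (C n c)" and cover: "\<And>n x. \<exists>c. x \<in> C n c"
  obtains g where "\<And>x. \<forall>\<^sub>F n in sequentially. \<exists>c\<le>g n. x \<in> C n c"
proof -
  have "\<exists>D. (\<forall>j. open (D j) \<and> closed (D j)) \<and> incseq D \<and> - C n c = (\<Union>j. D j)" for n c
    using open_increasing_clopen[of "- C n c"] closed by (metis open_Compl)
  then obtain D where D: "\<And>n c j. open (D n c j)" "\<And>n c j. closed (D n c j)"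
    "\<And>n c. incseq (D n c)" "\<And>n c. - C n c = (\<Union>j. D n c j)"
    by metis
  \<comment> \<open>The approximations at stage \<open>j\<close> contain \<open>C n c\<close>. The
    disjunct \<open>j \<le> c\<close> keeps the condition clopen and caps the value at
    \<open>j\<close>; it has no effect once \<open>j\<close> exceeds
    \<open>\<Phi> x n\<close>.\<close>
  define F where "F = (\<lambda>j x n. LEAST c. x \<notin> D n c j \<or> j \<le> c)"
  define \<Phi> where "\<Phi> = (\<lambda>x n. LEAST c. x \<in> C n c)"
  have "continuous_on UNIV (F j)" for j
    unfolding F_def
  proof (intro continuous_on_coordinatewise_then_product continuous_on_Least_clopen)
    fix n c
    have "{x. x \<notin> D n c j \<or> j \<le> c} = (if j \<le> c then UNIV else - D n c j)"
      by auto
    then show "open {x. x \<notin> D n c j \<or> j \<le> c}" "closed {x. x \<notin> D n c j \<or> j \<le> c}"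
      using D by auto
  qed auto
  moreover have "(\<lambda>j. F j x) \<longlonglongrightarrow> \<Phi> x" for x
    unfolding tendsto_fun_nat_iff
  proof
    fix n
    have in_\<Phi>: "x \<in> C n (\<Phi> x n)"
      unfolding \<Phi>_def using cover by (rule LeastI_ex)
    have ev: "\<forall>\<^sub>F j in sequentially. x \<in> D n c j" if "c < \<Phi> x n" for c
    proof -
      have "x \<in> - C n c"
        using that not_less_Least unfolding \<Phi>_def by blast
      then obtain j0 where "x \<in> D n c j0"
        using D(4) by blast
      then have "x \<in> D n c j" if "j \<ge> j0" for j
        using D(3) that by (meson in_mono incseqD)
      then show ?thesis
        by (auto simp: eventually_sequentially)
    qed
    \<comment> \<open>Only finitely many indices lie below \<open>\<Phi> x n\<close>, so one stage
      excludes them all.\<close>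
    have "\<forall>\<^sub>F j in sequentially. \<forall>c\<in>{..<\<Phi> x n}. x \<in> D n c j"
      by (rule eventually_ball_finite) (auto intro: ev)
    with eventually_gt_at_top[of "\<Phi> x n"]
    show "\<forall>\<^sub>F j in sequentially. F j x n = \<Phi> x n"
    proof eventually_elim
      case (elim j)
      have "x \<notin> D n (\<Phi> x n) j"
        using in_\<Phi> D(4) by blast
      with elim show ?case
        unfolding F_def by (intro Least_equality) (auto simp: not_less[symmetric])
    qed
  qed
  ultimately have "bounded_NN (range \<Phi>)"
    by (rule bounded_limit)
  then obtain g where g: "\<And>x. \<forall>\<^sub>F n in sequentially. \<Phi> x n \<le> g n"
    unfolding bounded_NN_def by auto
  show ?thesis
  proof (rule that)
    fix x
    show "\<forall>\<^sub>F n in sequentially. \<exists>c\<le>g n. x \<in> C n c"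
      using g[of x]
      by eventually_elim (metis LeastI_ex \<Phi>_def cover)
  qed
qed

lemma gdelta_imp_fsigma:
  fixes S :: "'a set"
  assumes "gdelta_in euclidean S"
  shows "fsigma_in euclidean S"
proof -
  obtain U where U: "\<And>n. open (U n)" "\<And>n. U (Suc n) \<subseteq> U n" "(\<Inter>n. U n) = S"
    using assms unfolding gdelta_in_descending by auto
  have dec: "decseq U"
    using U(2) by (rule decseq_SucI)
  have "\<exists>D. (\<forall>c. open (D c) \<and> closed (D c)) \<and> incseq D \<and> U n = (\<Union>c. D c)" for n
    using open_increasing_clopen[of "U n"] U(1) by metis
  then obtain D where D: "\<And>n c. closed (D n c)" "\<And>n. incseq (D n)"
    "\<And>n. U n = (\<Union>c. D n c)"
    by metis
  obtain g where g: "\<And>x. \<forall>\<^sub>F n in sequentially. \<exists>c\<le>g n. x \<in> - U n \<union> D n c"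
  proof (rule closed_covers_bounded[of "\<lambda>n c. - U n \<union> D n c"])
    show "closed (- U n \<union> D n c)" for n c
      using U(1)[of n] D(1)[of n c] by (intro closed_Un) (simp add: closed_def)
    show "\<exists>c. x \<in> - U n \<union> D n c" for n x
      using D(3) by blast
  qed blast
  have "S = (\<Union>m. \<Inter>n\<in>{m..}. D n (g n))"
  proof (intro equalityI subsetI)
    fix x assume "x \<in> S"
    then have "x \<in> U n" for n
      using U(3) by blast
    with g[of x] have "\<forall>\<^sub>F n in sequentially. x \<in> D n (g n)"
      \<comment> \<open>As \<open>D n\<close> increases, membership at some
        \<open>c \<le> g n\<close> passes up to \<open>g n\<close>.\<close>
      by (elim eventually_mono) (use D(2) in \<open>auto dest: incseqD\<close>)
    then show "x \<in> (\<Union>m. \<Inter>n\<in>{m..}. D n (g n))"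
      by (auto simp: eventually_sequentially)
  next
    fix x assume "x \<in> (\<Union>m. \<Inter>n\<in>{m..}. D n (g n))"
    then obtain m where "\<And>n. n \<ge> m \<Longrightarrow> x \<in> D n (g n)"
      by auto
    then have m: "\<And>n. n \<ge> m \<Longrightarrow> x \<in> U n"
      using D(3) by blast
    \<comment> \<open>The tail suffices because \<open>U\<close> decreases.\<close>
    have "x \<in> U n" for n
      using m[of "max m n"] decseqD[OF dec, of n "max m n"] by auto
    then show "x \<in> S"
      using U(3) by blast
  qed
  moreover have "fsigma_in euclidean (\<Union>m. \<Inter>n\<in>{m..}. D n (g n))"
    proof (rule fsigma_in_Union)
    show "fsigma_in euclidean T" if "T \<in> range (\<lambda>m. \<Inter>n\<in>{m..}. D n (g n))" for T
      using that D(1) by (auto intro!: closed_imp_fsigma_in closed_INT)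
  qed simp
  ultimately show ?thesis
    by simp
qed

text \<open>The complement of an \<open>F_sigma\<close> set is \<open>G_delta\<close>, hence again
  \<open>F_sigma\<close> here, so the \<open>F_sigma\<close> sets form a sigma-algebra containing
  the open sets.\<close>

lemma borel_imp_fsigma:
  fixes S :: "'a set"
  assumes "S \<in> sets borel"
  shows "fsigma_in euclidean S"
proof -
  have "S \<in> sigma_sets UNIV {U::'a set. open U}"
    using assms by (simp add: sets_borel)
  then show ?thesis
  proof (induction rule: sigma_sets.induct)
    case (Basic U)
    then show ?case
      by (intro gdelta_imp_fsigma open_imp_gdelta_in) simp
  next
    case (Compl A)
    then show ?case
      using gdelta_imp_fsigma[of "UNIV - A"] fsigma_in_gdelta_in[of euclidean A] by simp
  next
    case (Union A)
    then show ?case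
      by (auto intro: fsigma_in_Union)
  qed auto
qed

lemma borel_image_bounded:
  fixes \<Psi> :: "'a \<Rightarrow> nat \<Rightarrow> nat"
  assumes "\<Psi> \<in> borel_measurable borel"
  shows "bounded_NN (range \<Psi>)"
proof -
  have "fsigma_in euclidean {x. \<Psi> x n \<le> k}" for n k
  proof (rule borel_imp_fsigma)
    have "open ((\<lambda>f::nat \<Rightarrow> nat. f n) -` {..k})"
      by (rule open_vimage[OF open_discrete continuous_on_product_coordinates])
    then have "\<Psi> -` ((\<lambda>f. f n) -` {..k}) \<inter> space borel \<in> sets borel"
      using assms by (intro measurable_sets) auto
    then show "{x. \<Psi> x n \<le> k} \<in> sets borel"
      by (simp add: vimage_def)
  qed
  then have "\<exists>E::nat \<Rightarrow> 'a set. (\<forall>m. closed (E m)) \<and> {x. \<Psi> x n \<le> k} = \<Union>(range E)" for n k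
    by (rule fsigma_in_closed_sequence)
  then obtain E :: "nat \<Rightarrow> nat \<Rightarrow> nat \<Rightarrow> 'a set" where E: "\<And>n k m. closed (E n k m)"
    "\<And>n k. {x. \<Psi> x n \<le> k} = (\<Union>m. E n k m)"
    by metis
  \<comment> \<open>The index \<open>c\<close> codes a pair \<open>(k, m)\<close> with \<open>k \<le> c\<close>, so \<open>x \<in> C n c\<close> forces \<open>\<Psi> x n \<le> c\<close>.\<close>
  define C where "C = (\<lambda>n c. case prod_decode c of (k, m) \<Rightarrow> E n k m)"
  obtain g where g: "\<And>x. \<forall>\<^sub>F n in sequentially. \<exists>c\<le>g n. x \<in> C n c"
  proof (rule closed_covers_bounded[of C])
    show "closed (C n c)" for n c
      using E(1) by (simp add: C_def split: prod.split)
    show "\<exists>c. x \<in> C n c" for n x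
    proof -
      obtain m where "x \<in> E n (\<Psi> x n) m"
        using E(2)[of n "\<Psi> x n"] by auto
      then have "x \<in> C n (prod_encode (\<Psi> x n, m))"
        by (simp add: C_def)
      then show ?thesis ..
    qed
  qed blast
  have le: "\<Psi> x n \<le> c" if "x \<in> C n c" for x n c
  proof -
    obtain k m where km: "prod_decode c = (k, m)"
      by fastforce
    then have "x \<in> E n k m"
      using that by (simp add: C_def)
    then have "\<Psi> x n \<le> k"
      using E(2)[of n k] by auto
    also have "k \<le> c"
      using km by (metis le_prod_encode_1 prod_decode_inverse)
    finally show ?thesis .
  qed
  have "\<forall>\<^sub>F n in sequentially. \<Psi> x n \<le> g n" for x
    using g[of x] by eventually_elim (use le le_trans in blast)
  then show ?thesis
    unfolding bounded_NN_def by auto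
qed

end

section \<open>Comparison of the Baire classes with Borel functions and with limits of continuous
  functions\<close>

lemma baire_class_imp_borel:
  assumes "baire_class r i f"
  shows "f \<in> borel_measurable borel"
  using assms
proof (induction rule: baire_class.induct)
  case (class_zero i f)
  then show ?case
    by (intro borel_measurable_continuous_onI)
next
  case (class_limit i F f)
  have F: "F m \<in> borel_measurable borel" for m
    using class_limit.IH by blast
  show ?case
  proof (rule measurable_coordinatewise_then_product)
    fix n
    \<comment> \<open>Casting to \<open>real\<close> allows the theorem on limits of real measurable
      functions; fibres over integers then lead back to \<open>nat\<close>.\<close>
    have F_real: "(\<lambda>x. real (F m x n)) \<in> borel_measurable borel" for m
      by (rule measurable_compose[OF measurable_product_then_coordinatewise[OF F]])
        (simp add: borel_measurable_continuous_onI)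
    have "(\<lambda>m. real (F m x n)) \<longlonglongrightarrow> real (f x n)" for x
      using class_limit.hyps(3)
      unfolding tendsto_fun_nat_iff by (intro tendsto_eventually) (simp add: eventually_mono)
    with F_real have "(\<lambda>x. real (f x n)) \<in> borel_measurable borel"
      by (rule borel_measurable_LIMSEQ_real[rotated])
    then have "(\<lambda>x. real (f x n)) -` {real k} \<inter> space borel \<in> sets borel" for k
      by (rule measurable_sets) simp
    then have fib: "{x. f x n = k} \<in> sets borel" for k
      by (simp add: vimage_def)
    show "(\<lambda>x. f x n) \<in> borel_measurable borel"
    proof (rule borel_measurableI)
      fix B :: "nat set"
      have "(\<lambda>x. f x n) -` B \<inter> space borel = (\<Union>k\<in>B. {x. f x n = k})"
        by auto
      then show "(\<lambda>x. f x n) -` B \<inter> space borel \<in> sets borel"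
        using fib by auto
    qed
  qed
qed

text \<open>The least position below \<open>i\<close> stands for the ordinal 0, so every
  \<open>F m\<close> has a class strictly below \<open>i\<close>.\<close>

lemma limit_of_continuous_baire_class:
  fixes F :: "nat \<Rightarrow> 'a::topological_space \<Rightarrow> nat \<Rightarrow> nat"
  assumes wo: "Well_order r" and i: "i \<in> Field r" and pos: "strict_below r i \<noteq> {}"
    and F: "\<And>m. continuous_on UNIV (F m)" "\<And>x. (\<lambda>m. F m x) \<longlonglongrightarrow> f x"
  shows "baire_class r i f"
proof -
  have ord: "trans r" "antisym r" "wf (r - Id)"
    using wo by (auto simp: well_order_on_def linear_order_on_def partial_order_on_def
        preorder_on_def)
  obtain z where z: "z \<in> strict_below r i"
    and min: "\<And>y. (y, z) \<in> r - Id \<Longrightarrow> y \<notin> strict_below r i"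
    using wfE_min[OF ord(3)] pos by (metis ex_in_conv)
  have "strict_below r z = {}"
  proof (rule equals0I)
    fix y assume "y \<in> strict_below r z"
    then have y: "(y, z) \<in> r" "y \<noteq> z"
      by (simp_all add: strict_below_def)
    have zi: "(z, i) \<in> r" "z \<noteq> i"
      using z by (simp_all add: strict_below_def)
    have "(y, i) \<in> r"
      using ord(1) y(1) zi(1) by (rule transD)
    moreover have "y \<noteq> i"
      \<comment> \<open>If \<open>y = i\<close>, then \<open>z\<close> and \<open>i\<close> would
        precede each other and coincide.\<close>
      using antisymD[OF ord(2) zi(1)] y zi by blast
    ultimately show False
      using min[of y] y by (simp add: strict_below_def)
  qed
  moreover have "z \<in> Field r"
    using z by (auto simp: strict_below_def intro: FieldI1)
  ultimately have "baire_class r z (F m)" for m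
    using F(1) by (intro class_zero)
  with z have "\<forall>m. \<exists>j\<in>strict_below r i. baire_class r j (F m)"
    by blast
  with i pos show ?thesis
    by (rule class_limit) (simp add: F(2))
qed

theorem mainTheorem16:
  fixes r :: "'i rel" and i :: 'i
  assumes X: "\<forall>U::'a::topological_space set. open U \<longrightarrow>
                (\<exists>C. countable C \<and> (\<forall>c \<in> C. open c \<and> closed c) \<and> U = \<Union>C)"
    and wo: "Well_order r" and iF: "i \<in> Field r"
    and pos: "strict_below r i \<noteq> {}"
    and le: "ord_le_omega1 r i"
  shows "(\<forall>\<Psi> :: 'a \<Rightarrow> (nat \<Rightarrow> nat). baire_class r i \<Psi> \<longrightarrow> bounded_NN (range \<Psi>))
     \<longleftrightarrow> (\<forall>\<Psi> :: 'a \<Rightarrow> (nat \<Rightarrow> nat). \<Psi> \<in> borel_measurable borel \<longrightarrow> bounded_NN (range \<Psi>))"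
proof
  assume bounded: "\<forall>\<Psi> :: 'a \<Rightarrow> (nat \<Rightarrow> nat). baire_class r i \<Psi> \<longrightarrow> bounded_NN (range \<Psi>)"
  interpret baire_one_bounded "TYPE('a)"
  proof
    fix F :: "nat \<Rightarrow> 'a \<Rightarrow> nat \<Rightarrow> nat" and \<Phi>
    assume "\<And>m. continuous_on UNIV (F m)" "\<And>x. (\<lambda>m. F m x) \<longlonglongrightarrow> \<Phi> x"
    then have "baire_class r i \<Phi>"
      by (rule limit_of_continuous_baire_class[OF wo iF pos])
    then show "bounded_NN (range \<Phi>)"
      using bounded by simp
  qed (rule X[rule_format])
  show "\<forall>\<Psi> :: 'a \<Rightarrow> (nat \<Rightarrow> nat). \<Psi> \<in> borel_measurable borel \<longrightarrow> bounded_NN (range \<Psi>)"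
    by (simp add: borel_image_bounded)
\<comment> \<open>Conversely, every function in the hierarchy is Borel.\<close>
qed (simp add: baire_class_imp_borel)

end
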